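(* For every real number $t\geqslant0$, the sequence of polynomials $\{A_n(q;t)\}_{n\geqslant0}$ in $q$ is strongly $q$-log-convex.
   Context: For $n\geqslant0$, $A_n(q;t):=\sum_{\pi\in S_n}q^{\mathrm{exc}(\pi)}t^{c(\pi)}$, where $\mathrm{exc}(\pi)$ is the number of excedances of $\pi$ (indices $i$ with $\pi(i)>i$) and $c(\pi)$ is the number of cycles of $\pi$ (so $A_0(q;t)=1$). Equivalently, as formal power series in $x$, $$\sum_{n\geqslant0}A_n(q;t)\frac{x^n}{n!}=\left(\frac{(1-q)e^{x(1-q)}}{1-qe^{x(1-q)}}\right)^t .$$ For real polynomials $f(q),g(q)$, write $f(q)\geqslant_q g(q)$ if $f(q)-g(q)$ has only nonnegative coefficients as a polynomial in $q$. A sequence $\{f_n(q)\}_{n\geqslant0}$ of real polynomials is strongly $q$-log-convex if $f_{m-1}(q)f_{n+1}(q)\geqslant_q f_m(q)f_n(q)$ for all $n\geqslant m\geqslant 1$. *)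

theory Defs
  imports
    Complex_Main
    "HOL-Combinatorics.Permutations"
    "HOL-Combinatorics.Orbits"
    "HOL-Computational_Algebra.Polynomial"
begin

text \<open>Elements of \<open>S\<^sub>n\<close> are the functions \<open>p\<close> with \<^term>\<open>p permutes {1..n::nat}\<close>;
  they are the identity outside \<open>{1..n}\<close>, hence the restriction to \<open>{1..n}\<close> below.\<close>

definition exc :: "nat \<Rightarrow> (nat \<Rightarrow> nat) \<Rightarrow> nat" where
  "exc n p = card {i \<in> {1..n}. p i > i}"

text \<open>Cycles are identified with their underlying sets, the orbits of \<open>p\<close> on \<open>{1..n}\<close>;
  fixed points count as cycles.\<close>

definition cyc :: "nat \<Rightarrow> (nat \<Rightarrow> nat) \<Rightarrow> nat" where
  "cyc n p = card (orbit p ` {1..n})"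

text \<open>\<open>A\<^sub>n(q;t)\<close> for a fixed real \<open>t\<close>, as a polynomial in the formal variable \<open>q\<close>.
  At \<open>t = 0\<close> the convention \<open>0 ^ 0 = 1\<close> gives \<open>A\<^sub>0(q;0) = 1\<close>.\<close>

definition eulerian_poly :: "nat \<Rightarrow> real \<Rightarrow> real poly" where
  "eulerian_poly n t = (\<Sum>p | p permutes {1..n}. monom (t ^ cyc n p) (exc n p))"

definition q_ge :: "real poly \<Rightarrow> real poly \<Rightarrow> bool"  (infix "\<ge>\<^sub>q" 50) where
  "f \<ge>\<^sub>q g \<longleftrightarrow> (\<forall>k. coeff (f - g) k \<ge> 0)"

definition strongly_q_log_convex :: "(nat \<Rightarrow> real poly) \<Rightarrow> bool" where
  "strongly_q_log_convex f \<longleftrightarrow>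
     (\<forall>m n. 1 \<le> m \<and> m \<le> n \<longrightarrow> f (m - 1) * f (n + 1) \<ge>\<^sub>q f m * f n)"

end

theory Submission
  imports Defs
begin

text \<open>
  The idea is to exhibit the \<open>A\<^sub>n(q;t)\<close> as the zeroth column of an infinite matrix whose rows are
  generated by a tridiagonal matrix, and to read the log-convexity differences as minors of order 2.

  Give an excedance the weight \<open>Y = q(1+g)\<close>, any other element the weight \<open>X = 1+qg\<close> and a
  cycle the weight \<open>t\<close>, where \<open>g\<close> is a second variable, and let \<open>Q\<^sub>n\<close> be the sum of the weights of
  the permutations of \<open>{1..n}\<close>.  At \<open>g = 0\<close> it specialises to \<open>A\<^sub>n(q;t)\<close>.  Inserting \<open>n+1\<close> into a
  permutation either creates a new fixed point (a factor \<open>tX\<close>), or it splits an arc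
  \<open>i \<mapsto> p(i)\<close> into \<open>i \<mapsto> n+1 \<mapsto> p(i)\<close>, after which \<open>i\<close> is an excedance and \<open>n+1\<close> is not: an excedance
  gives the factor \<open>X\<close>, any other \<open>i\<close> turns its weight \<open>X\<close> into \<open>XY\<close>.  Because
  \<open>(1+g) dY/dg = Y\<close> and \<open>(1+g) dX/dg = Y\<close>, splitting an arc in all possible ways is the derivation
  \<open>X(1+g) d/dg\<close>, so \<open>Q\<^sub>n\<^sub>+\<^sub>1 = X ((1+g) d/dg + t) Q\<^sub>n\<close> (\<open>shifted_eulerian_Suc\<close>).

  Expanded in powers of \<open>g\<close>, this operator is tridiagonal (\<open>coeff_raise\<close>): it sends \<open>g\<^sup>k\<close> to
  \<open>k g\<^sup>k\<^sup>-\<^sup>1 + (t+k(1+q)) g\<^sup>k + q(t+k) g\<^sup>k\<^sup>+\<^sup>1\<close>.  For \<open>t \<ge> 0\<close> all its minors of order 2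
  have nonnegative coefficients in \<open>q\<close>, and by the Cauchy-Binet formula the same holds for the
  matrix \<open>N\<close> with rows \<open>N\<^sub>n = (coefficients of Q\<^sub>n)\<close> (\<open>minor_tridiag_iterates_nonneg\<close>).
  Finally \<open>A\<^sub>n\<^sub>+\<^sub>1 = t N\<^sub>n\<^sub>,\<^sub>0 + N\<^sub>n\<^sub>,\<^sub>1\<close>; the terms in \<open>t\<close> cancel in
  \<open>A\<^sub>m\<^sub>-\<^sub>1 A\<^sub>n\<^sub>+\<^sub>1 - A\<^sub>m A\<^sub>n\<close>, which leaves the minor of \<open>N\<close> in rows \<open>m-1, n\<close> and
  columns \<open>0, 1\<close>.
\<close>

section \<open>Inserting a new largest element\<close>

text \<open>The library enumerates the permutations of \<open>insert a S\<close> as \<open>transpose a b \<circ> q\<close>; the form with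
  \<open>b = q i\<close> shows that \<open>a\<close> is spliced into the cycle of \<open>q\<close> directly after \<open>i\<close>.\<close>

lemma transpose_comp_eq_fun_upd:
  assumes "q permutes S" "a \<notin> S" "i \<in> S"
  shows "transpose a (q i) \<circ> q = q(i := a, a := q i)"
proof
  fix x
  have "q a = a" using assms by (simp add: permutes_not_in)
  moreover have "q x = q i \<longleftrightarrow> x = i" "q x = q a \<longleftrightarrow> x = a"
    using permutes_inj[OF assms(1)] by (auto dest: injD)
  ultimately show "(transpose a (q i) \<circ> q) x = (q(i := a, a := q i)) x"
    using assms by (auto simp: transpose_def)
qed

text \<open>Apart from the detour \<open>i \<mapsto> a \<mapsto> q i\<close> the two maps agree, so an orbit of the new map visits the
  same points of \<open>S\<close>.\<close>

lemma orbit_insert_Int: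
  assumes q: "q permutes S" "finite S" and a: "a \<notin> S" and i: "i \<in> S" and x: "x \<in> S"
  shows "orbit (q(i := a, a := q i)) x \<inter> S = orbit q x" (is "orbit ?p x \<inter> S = _")
proof
  have self: "y \<in> orbit q y" for y
    using q by (meson permutation_permutes permutation_self_in_orbit)
  have qS: "q y \<in> S \<longleftrightarrow> y \<in> S" for y
    using q by (simp add: permutes_in_image)
  have ai: "a \<noteq> i" using a i by auto
  \<comment> \<open>Reaching \<open>a\<close> is possible only from \<open>i\<close>; remembering this is what makes the induction go through.\<close>
  have "(y \<in> S \<and> y \<in> orbit q x) \<or> (y = a \<and> i \<in> orbit q x)" if "y \<in> orbit ?p x" for y
    using that
  proof induction
    case base
    then show ?case using x a qS self by (auto intro: orbit.intros)
  next
    case (step y)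
    then show ?case using i a qS by (auto intro: orbit.intros)
  qed
  then show "orbit ?p x \<inter> S \<subseteq> orbit q x" using a by auto
  have two: "q y \<in> orbit ?p x" if "y \<in> orbit ?p x" "y \<in> S" for y
  proof (cases "y = i")
    case True
    then have "?p (?p y) = q y" using ai by simp
    then show ?thesis using that(1) orbit.step by metis
  next
    case False
    then have "?p y = q y" using that a by auto
    then show ?thesis using that(1) orbit.step by metis
  qed
  have "y \<in> orbit ?p x \<and> y \<in> S" if "y \<in> orbit q x" for y
    using that
  proof induction
    case base
    have "q x \<in> orbit ?p x"
    proof (cases "x = i")
      case True
      then have "?p (?p x) = q x" using ai by simp
      then show ?thesis using orbit.intros by metis
    next
      case False
      then have "?p x = q x" using x a by auto
      then show ?thesis using orbit.base by metis
    qed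
    then show ?case using x qS by (simp del: fun_upd_apply)
  next
    case (step y)
    then show ?case using two qS by (simp del: fun_upd_apply)
  qed
  then show "orbit q x \<subseteq> orbit ?p x \<inter> S" by auto
qed

text \<open>Every new orbit meets \<open>S\<close>, because \<open>a\<close> lies in the orbit of \<open>i\<close>; hence intersecting with \<open>S\<close>
  matches the new orbits with the old ones.\<close>

lemma card_orbits_insert:
  assumes q: "q permutes S" "finite S" and a: "a \<notin> S" and i: "i \<in> S"
  shows "card (orbit (q(i := a, a := q i)) ` insert a S) = card (orbit q ` S)"
    (is "card (orbit ?p ` _) = _")
proof -
  have "q permutes insert a S" by (rule permutes_imp_permutes_insert[OF q(1)])
  then have "transpose a (q i) \<circ> q permutes insert a S"
    using i q by (intro permutes_compose permutes_swap_id) (auto simp: permutes_in_image)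
  then have "?p permutes insert a S"
    using transpose_comp_eq_fun_upd[OF q(1) a i] by simp
  then have p: "permutation ?p" using q(2) by (meson finite_insert permutation_permutes)
  have inj: "inj_on (\<lambda>C. C \<inter> S) (orbit ?p ` S)"
  proof (rule inj_onI, clarify)
    fix x y assume "x \<in> S" "y \<in> S" "orbit ?p x \<inter> S = orbit ?p y \<inter> S"
    then have "x \<in> orbit ?p y" using permutation_self_in_orbit[OF p, of x] by blast
    then show "orbit ?p x = orbit ?p y"
      using orbit_cyclic_eq3[OF cyclic_on_orbit'[OF p]] by blast
  qed
  have "orbit ?p (?p i) = orbit ?p i" by (rule permutation_orbit_step[OF p])
  then have "orbit ?p a = orbit ?p i" using a i by (auto split: if_splits)
  then have "orbit ?p ` insert a S = orbit ?p ` S" using i by auto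
  moreover have "(\<lambda>C. C \<inter> S) ` orbit ?p ` S = orbit q ` S"
    using orbit_insert_Int[OF q a i] by (simp add: image_image)
  ultimately show ?thesis using card_image[OF inj] by simp
qed

lemma exc_insert:
  assumes q: "q permutes {1..n}" and i: "i \<in> {1..n}"
  shows "exc (Suc n) (q(i := Suc n, Suc n := q i)) = (if q i > i then exc n q else Suc (exc n q))"
proof -
  let ?E = "{j \<in> {1..n}. q j > j}"
  have "q i \<in> {1..n}" using i permutes_in_image[OF q] by blast
  then have "{j \<in> {1..Suc n}. (q(i := Suc n, Suc n := q i)) j > j} = insert i ?E"
    using i by (auto simp: le_Suc_eq split: if_splits)
  then show ?thesis using i by (auto simp: exc_def insert_absorb)
qed

lemma cyc_insert:
  assumes "q permutes {1..n}" "i \<in> {1..n}"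
  shows "cyc (Suc n) (q(i := Suc n, Suc n := q i)) = cyc n q"
  using card_orbits_insert[of q "{1..n}" "Suc n" i] assms
  by (simp add: cyc_def atLeastAtMostSuc_conv)

lemma exc_fixed: "q permutes {1..n} \<Longrightarrow> exc (Suc n) q = exc n q"
proof -
  assume "q permutes {1..n}"
  then have "q (Suc n) = Suc n" by (simp add: permutes_not_in)
  then have "{j \<in> {1..Suc n}. q j > j} = {j \<in> {1..n}. q j > j}"
    by (auto simp: le_Suc_eq)
  then show ?thesis by (simp add: exc_def)
qed

lemma cyc_fixed:
  assumes q: "q permutes {1..n}" shows "cyc (Suc n) q = Suc (cyc n q)"
proof -
  have "orbit q (Suc n) = {Suc n}"
    using q by (simp add: orbit_eq_singleton_iff permutes_not_in)
  moreover have "{Suc n} \<notin> orbit q ` {1..n}"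
    using permutes_orbit_subset[OF q] by fastforce
  ultimately show ?thesis by (simp add: cyc_def atLeastAtMostSuc_conv)
qed

lemma exc_le: "exc n p \<le> n"
  unfolding exc_def by (rule order_trans[OF card_mono[of "{1..n}"]]) auto

text \<open>The three summands are the insertions of \<open>n + 1\<close> as a fixed point, after an excedance,
  and after an element that is not an excedance.\<close>

lemma sum_permutations_Suc:
  fixes F :: "nat \<Rightarrow> nat \<Rightarrow> 'a::comm_semiring_1"
  shows "(\<Sum>p | p permutes {1..Suc n}. F (exc (Suc n) p) (cyc (Suc n) p)) =
    (\<Sum>p | p permutes {1..n}. F (exc n p) (Suc (cyc n p))
       + of_nat (exc n p) * F (exc n p) (cyc n p)
       + of_nat (n - exc n p) * F (Suc (exc n p)) (cyc n p))"
proof -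
  let ?G = "\<lambda>p. F (exc (Suc n) p) (cyc (Suc n) p)"
  have "sum ?G {p. p permutes {1..Suc n}} = sum ?G {p. p permutes insert (Suc n) {1..n}}"
    by (simp add: atLeastAtMostSuc_conv)
  also have "\<dots> = (\<Sum>b\<in>insert (Suc n) {1..n}. \<Sum>q | q permutes {1..n}. ?G (transpose (Suc n) b \<circ> q))"
    by (rule sum_over_permutations_insert) auto
  also have "\<dots> = (\<Sum>q | q permutes {1..n}. \<Sum>b\<in>insert (Suc n) {1..n}. ?G (transpose (Suc n) b \<circ> q))"
    by (rule sum.swap)
  also have "\<dots> = (\<Sum>p | p permutes {1..n}. F (exc n p) (Suc (cyc n p))
       + of_nat (exc n p) * F (exc n p) (cyc n p)
       + of_nat (n - exc n p) * F (Suc (exc n p)) (cyc n p))"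
  proof (rule sum.cong[OF refl], clarify)
    fix q assume q: "q permutes {1..n}"
    let ?e = "exc n q" and ?c = "cyc n q"
    let ?E = "{i \<in> {1..n}. q i > i}"
    \<comment> \<open>Index by the predecessor \<open>i\<close> of \<open>n + 1\<close> instead of its image \<open>b = q i\<close>.\<close>
    have "(\<Sum>b\<in>{1..n}. ?G (transpose (Suc n) b \<circ> q))
        = (\<Sum>i\<in>{1..n}. ?G (transpose (Suc n) (q i) \<circ> q))"
      by (subst sum.permute[OF q]) (simp only: comp_def)
    also have "\<dots> = (\<Sum>i\<in>{1..n}. if q i > i then F ?e ?c else F (Suc ?e) ?c)"
    proof (rule sum.cong[OF refl])
      fix i assume i: "i \<in> {1..n}"
      have "transpose (Suc n) (q i) \<circ> q = q(i := Suc n, Suc n := q i)"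
        by (rule transpose_comp_eq_fun_upd[OF q _ i]) simp
      then show "?G (transpose (Suc n) (q i) \<circ> q) = (if q i > i then F ?e ?c else F (Suc ?e) ?c)"
        by (simp only: exc_insert[OF q i] cyc_insert[OF q i] split: if_split) simp
    qed
    also have "\<dots> = of_nat (card ?E) * F ?e ?c + of_nat (card ({1..n} - ?E)) * F (Suc ?e) ?c"
    proof -
      have "{1..n} \<inter> {i. q i > i} = ?E" "{1..n} \<inter> - {i. q i > i} = {1..n} - ?E"
        by auto
      then show ?thesis by (simp only: sum.If_cases finite_atLeastAtMost sum_constant)
    qed
    also have "card ({1..n} - ?E) = n - ?e"
      by (subst card_Diff_subset) (auto simp: exc_def)
    also have "card ?E = ?e" by (simp add: exc_def)
    finally have moved: "(\<Sum>b\<in>{1..n}. ?G (transpose (Suc n) b \<circ> q))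
        = of_nat ?e * F ?e ?c + of_nat (n - ?e) * F (Suc ?e) ?c" .
    have "(\<Sum>b\<in>insert (Suc n) {1..n}. ?G (transpose (Suc n) b \<circ> q))
        = ?G (transpose (Suc n) (Suc n) \<circ> q) + (\<Sum>b\<in>{1..n}. ?G (transpose (Suc n) b \<circ> q))"
      by (rule sum.insert) auto
    then show "(\<Sum>b\<in>insert (Suc n) {1..n}. ?G (transpose (Suc n) b \<circ> q))
        = F ?e (Suc ?c) + of_nat ?e * F ?e ?c + of_nat (n - ?e) * F (Suc ?e) ?c"
      unfolding moved using exc_fixed[OF q] cyc_fixed[OF q] by (simp add: add.assoc)
  qed
  finally show ?thesis .
qed

section \<open>Nonnegative polynomials and tridiagonal recurrences\<close>

lemma q_ge_iff_diff: "f \<ge>\<^sub>q g \<longleftrightarrow> f - g \<ge>\<^sub>q 0"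
  by (simp add: q_ge_def)

lemma q_ge_0_add: "f \<ge>\<^sub>q 0 \<Longrightarrow> g \<ge>\<^sub>q 0 \<Longrightarrow> f + g \<ge>\<^sub>q 0"
  by (simp add: q_ge_def)

lemma q_ge_0_mult: "f \<ge>\<^sub>q 0 \<Longrightarrow> g \<ge>\<^sub>q 0 \<Longrightarrow> f * g \<ge>\<^sub>q 0"
  by (auto simp: q_ge_def coeff_mult intro!: sum_nonneg)

lemma q_ge_0_pCons [simp]: "pCons a f \<ge>\<^sub>q 0 \<longleftrightarrow> a \<ge> 0 \<and> f \<ge>\<^sub>q 0"
  by (auto simp: q_ge_def coeff_pCons split: nat.splits)

lemma q_ge_0_0 [simp]: "0 \<ge>\<^sub>q 0"
  by (simp add: q_ge_def)

text \<open>The row vector \<open>u\<close> times the tridiagonal matrix whose entries in column \<open>k\<close> are \<open>\<alpha> k\<close>, \<open>\<gamma> k\<close>,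
  \<open>\<beta> k\<close>, in rows \<open>k - 1\<close>, \<open>k\<close>, \<open>k + 1\<close>.  For \<open>k = 0\<close> the truncated \<open>k - 1\<close> is harmless as long as
  \<open>\<alpha> 0 = 0\<close>, which is assumed below.\<close>

definition tridiag :: "(nat \<Rightarrow> 'a) \<Rightarrow> (nat \<Rightarrow> 'a) \<Rightarrow> (nat \<Rightarrow> 'a) \<Rightarrow> (nat \<Rightarrow> 'a) \<Rightarrow> nat \<Rightarrow> 'a::comm_ring_1"
  where "tridiag \<alpha> \<gamma> \<beta> u k = \<alpha> k * u (k - 1) + \<gamma> k * u k + \<beta> k * u (Suc k)"

definition minor :: "(nat \<Rightarrow> 'a) \<Rightarrow> (nat \<Rightarrow> 'a) \<Rightarrow> nat \<Rightarrow> nat \<Rightarrow> 'a::comm_ring_1"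
  where "minor u v k l = u k * v l - u l * v k"

text \<open>The Cauchy-Binet formula for minors of order 2, written out: a minor of the product is a sum of
  minors of \<open>u, v\<close> times minors of the tridiagonal matrix.  The only minors of the latter
  that are not just products of entries are those of adjacent rows and columns \<open>k, k + 1\<close>, whence
  the hypothesis \<open>det\<close>.\<close>

lemma minor_tridiag_nonneg:
  fixes \<alpha> \<beta> \<gamma> u v :: "nat \<Rightarrow> real poly"
  assumes nonneg: "\<And>k. \<alpha> k \<ge>\<^sub>q 0" "\<And>k. \<gamma> k \<ge>\<^sub>q 0" "\<And>k. \<beta> k \<ge>\<^sub>q 0"
    and \<alpha>0: "\<alpha> 0 = 0"
    and det: "\<And>k. \<gamma> k * \<gamma> (Suc k) - \<beta> k * \<alpha> (Suc k) \<ge>\<^sub>q 0"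
    and uv: "\<And>k l. k < l \<Longrightarrow> minor u v k l \<ge>\<^sub>q 0"
    and "k < l"
  shows "minor (tridiag \<alpha> \<gamma> \<beta> u) (tridiag \<alpha> \<gamma> \<beta> v) k l \<ge>\<^sub>q 0"
proof -
  let ?m = "minor u v"
  have uv': "?m k l \<ge>\<^sub>q 0" if "k \<le> l" for k l
    using uv[of k l] that by (cases "k = l") (auto simp: minor_def)
  \<comment> \<open>For \<open>k = 0\<close> the column \<open>k - 1\<close> is spurious, but then the factor \<open>\<alpha> 0\<close> vanishes.\<close>
  have \<alpha>m: "\<alpha> k * c * ?m (k - 1) j \<ge>\<^sub>q 0" if "c \<ge>\<^sub>q 0" "k \<le> Suc j" for c j
    using that \<alpha>0 by (cases k) (auto intro!: q_ge_0_mult nonneg uv')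
  show ?thesis
  proof (cases "l = Suc k")
    case True
    \<comment> \<open>Of the nine terms, those for \<open>(k, k)\<close> and \<open>(l, l)\<close> vanish, and \<open>(l, k)\<close> is merged with \<open>(k, l)\<close>.\<close>
    have "minor (tridiag \<alpha> \<gamma> \<beta> u) (tridiag \<alpha> \<gamma> \<beta> v) k l =
        \<alpha> k * \<alpha> l * ?m (k - 1) k + \<alpha> k * \<gamma> l * ?m (k - 1) l + \<alpha> k * \<beta> l * ?m (k - 1) (Suc l)
      + (\<gamma> k * \<gamma> l - \<beta> k * \<alpha> l) * ?m k l + \<gamma> k * \<beta> l * ?m k (Suc l)
      + \<beta> k * \<beta> l * ?m l (Suc l)"
      unfolding True minor_def tridiag_def by (simp add: algebra_simps)
    then show ?thesis
      using det[of k] True by (auto intro!: q_ge_0_add \<alpha>m q_ge_0_mult nonneg uv')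
  next
    case False
    \<comment> \<open>The columns \<open>k - 1, k, k + 1\<close> and \<open>l - 1, l, l + 1\<close> are then in order, so no term is negative.\<close>
    with \<open>k < l\<close> have "Suc k \<le> l - 1" by auto
    have "minor (tridiag \<alpha> \<gamma> \<beta> u) (tridiag \<alpha> \<gamma> \<beta> v) k l =
        \<alpha> k * \<alpha> l * ?m (k - 1) (l - 1) + \<alpha> k * \<gamma> l * ?m (k - 1) l + \<alpha> k * \<beta> l * ?m (k - 1) (Suc l)
      + \<gamma> k * \<alpha> l * ?m k (l - 1) + \<gamma> k * \<gamma> l * ?m k l + \<gamma> k * \<beta> l * ?m k (Suc l)
      + \<beta> k * \<alpha> l * ?m (Suc k) (l - 1) + \<beta> k * \<gamma> l * ?m (Suc k) l
      + \<beta> k * \<beta> l * ?m (Suc k) (Suc l)"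
      unfolding minor_def tridiag_def by (simp add: algebra_simps)
    then show ?thesis
      using \<open>Suc k \<le> l - 1\<close> by (auto intro!: q_ge_0_add \<alpha>m q_ge_0_mult nonneg uv')
  qed
qed

text \<open>Undoing the recurrence in both rows simultaneously leads to minors with upper row 0; these are
  \<open>N 0 k * N n l\<close>, since \<open>N 0\<close> vanishes beyond column 0 and \<open>k < l\<close>.\<close>

lemma minor_tridiag_iterates_nonneg:
  fixes \<alpha> \<beta> \<gamma> :: "nat \<Rightarrow> real poly" and N :: "nat \<Rightarrow> nat \<Rightarrow> real poly"
  assumes nonneg: "\<And>k. \<alpha> k \<ge>\<^sub>q 0" "\<And>k. \<gamma> k \<ge>\<^sub>q 0" "\<And>k. \<beta> k \<ge>\<^sub>q 0"
    and \<alpha>0: "\<alpha> 0 = 0"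
    and det: "\<And>k. \<gamma> k * \<gamma> (Suc k) - \<beta> k * \<alpha> (Suc k) \<ge>\<^sub>q 0"
    and N0: "N 0 0 \<ge>\<^sub>q 0" "\<And>k. k > 0 \<Longrightarrow> N 0 k = 0"
    and N_Suc: "\<And>n. N (Suc n) = tridiag \<alpha> \<gamma> \<beta> (N n)"
    and "m \<le> n" "k < l"
  shows "minor (N m) (N n) k l \<ge>\<^sub>q 0"
proof -
  have entries: "N n k \<ge>\<^sub>q 0" for n k
  proof (induction n arbitrary: k)
    case 0
    show ?case using N0 by (cases k) auto
  next
    case (Suc n)
    show ?case unfolding N_Suc tridiag_def
      by (intro q_ge_0_add q_ge_0_mult nonneg Suc.IH)
  qed
  have "minor (N m) (N (m + d)) k l \<ge>\<^sub>q 0" if "k < l" for d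
    using that
  proof (induction m arbitrary: k l)
    case 0
    then show ?case using N0 entries by (simp add: minor_def q_ge_0_mult)
  next
    case (Suc m)
    then show ?case unfolding add_Suc N_Suc
      by (intro minor_tridiag_nonneg nonneg \<alpha>0 det)
  qed
  from this[of "n - m"] show ?thesis using \<open>m \<le> n\<close> \<open>k < l\<close> by simp
qed

section \<open>A polynomial whose coefficients satisfy a tridiagonal recurrence\<close>

abbreviation qX :: "real poly" where "qX \<equiv> [:0, 1:]"

text \<open>In the type \<^typ>\<open>real poly poly\<close> the inner variable is \<open>q\<close> and the outer one is \<open>g\<close>; the two
  weights are \<open>X = 1 + q g\<close> and \<open>Y = q + q g\<close>.\<close>

definition nonexc_weight :: "real poly poly" where "nonexc_weight = [:1, qX:]"

definition exc_weight :: "real poly poly" where "exc_weight = [:qX, qX:]"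

text \<open>Up to the factor \<open>X\<^sup>n\<close>, this is \<open>A\<^sub>n(Y/X; t)\<close>, the homogenised polynomial at \<open>(Y, X)\<close>.\<close>

definition shifted_eulerian :: "real \<Rightarrow> nat \<Rightarrow> real poly poly" where
  "shifted_eulerian t n =
     (\<Sum>p | p permutes {1..n}. [:[:t:]:] ^ cyc n p * exc_weight ^ exc n p * nonexc_weight ^ (n - exc n p))"

lemma coeff_0_shifted_eulerian: "coeff (shifted_eulerian t n) 0 = eulerian_poly n t"
proof -
  have "[:t:] ^ c * qX ^ e = monom (t ^ c) e" for c e :: nat
    by (simp add: poly_const_pow monom_altdef)
  then show ?thesis
    by (simp add: shifted_eulerian_def eulerian_poly_def coeff_sum coeff_mult_0 coeff_0_power
        exc_weight_def nonexc_weight_def)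
qed

lemma shifted_eulerian_0: "shifted_eulerian t 0 = 1"
  by (simp add: shifted_eulerian_def exc_def cyc_def)

definition raise :: "real \<Rightarrow> real poly poly \<Rightarrow> real poly poly" where
  "raise t P = nonexc_weight * ([:1, 1:] * pderiv P + [:[:t:]:] * P)"

lemma raise_add: "raise t (P + R) = raise t P + raise t R"
  unfolding raise_def pderiv_add by (simp only: distrib_left add_ac)

lemma raise_sum: "raise t (sum P A) = (\<Sum>a\<in>A. raise t (P a))"
proof (induction A rule: infinite_finite_induct)
  case (insert a A)
  then show ?case by (simp add: raise_add)
qed (simp_all add: raise_def)

text \<open>The derivation \<open>X(1+g) d/dg\<close> multiplies each factor \<open>Y\<close> by \<open>X\<close> and turns each factor \<open>X\<close> into
  \<open>XY\<close>, which mirrors the insertions in \<open>sum_permutations_Suc\<close>.\<close>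

lemma raise_monomial:
  fixes t :: real
  defines "c \<equiv> [:[:t:]:]"
  shows "raise t (c ^ k * exc_weight ^ e * nonexc_weight ^ d) =
    c ^ Suc k * exc_weight ^ e * nonexc_weight ^ Suc d
      + of_nat e * (c ^ k * exc_weight ^ e * nonexc_weight ^ Suc d)
      + of_nat d * (c ^ k * exc_weight ^ Suc e * nonexc_weight ^ d)"
proof -
  have deriv: "pderiv exc_weight = [:qX:]" "pderiv nonexc_weight = [:qX:]" "pderiv (c ^ k) = 0"
    by (simp_all add: exc_weight_def nonexc_weight_def pderiv_pCons c_def poly_const_pow)
  have smult: "smult (of_nat j) P = of_nat j * P" for j and P :: "real poly poly"
    by (simp add: of_nat_poly)
  have lin: "[:1, 1:] * [:qX:] = exc_weight"
    by (simp add: exc_weight_def)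
  have exc: "[:1, 1:] * pderiv (exc_weight ^ e) = of_nat e * exc_weight ^ e"
  proof (cases e)
    case (Suc e')
    have "[:1, 1:] * pderiv (exc_weight ^ e) = of_nat e * exc_weight ^ e' * ([:1, 1:] * [:qX:])"
      unfolding Suc pderiv_power_Suc deriv by (simp only: smult mult_ac)
    then show ?thesis unfolding lin by (simp add: Suc)
  qed simp
  have rest: "nonexc_weight * ([:1, 1:] * pderiv (nonexc_weight ^ d)) = of_nat d * (exc_weight * nonexc_weight ^ d)"
  proof (cases d)
    case (Suc d')
    have "nonexc_weight * ([:1, 1:] * pderiv (nonexc_weight ^ d))
        = of_nat d * nonexc_weight * nonexc_weight ^ d' * ([:1, 1:] * [:qX:])"
      unfolding Suc pderiv_power_Suc deriv by (simp only: smult mult_ac)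
    then show ?thesis unfolding lin by (simp add: Suc mult_ac)
  qed simp
  let ?Y = "exc_weight ^ e" and ?X = "nonexc_weight ^ d"
  have "raise t (c ^ k * ?Y * ?X) = c ^ Suc k * ?Y * nonexc_weight ^ Suc d
      + c ^ k * nonexc_weight * ?X * ([:1, 1:] * pderiv ?Y)
      + c ^ k * ?Y * (nonexc_weight * ([:1, 1:] * pderiv ?X))"
    unfolding raise_def pderiv_mult deriv c_def[symmetric] by (simp only: power_Suc) algebra
  then show ?thesis unfolding exc rest by (simp add: mult_ac)
qed

lemma shifted_eulerian_Suc: "shifted_eulerian t (Suc n) = raise t (shifted_eulerian t n)"
proof -
  let ?F = "\<lambda>e c. [:[:t:]:] ^ c * exc_weight ^ e * nonexc_weight ^ (Suc n - e)"
  have "shifted_eulerian t (Suc n) = (\<Sum>p | p permutes {1..n}. ?F (exc n p) (Suc (cyc n p))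
       + of_nat (exc n p) * ?F (exc n p) (cyc n p)
       + of_nat (n - exc n p) * ?F (Suc (exc n p)) (cyc n p))"
    unfolding shifted_eulerian_def by (rule sum_permutations_Suc)
  also have "\<dots> = raise t (shifted_eulerian t n)"
    unfolding shifted_eulerian_def raise_sum
    by (rule sum.cong[OF refl], subst raise_monomial) (simp only: Suc_diff_le[OF exc_le] diff_Suc_Suc)
  finally show ?thesis .
qed

text \<open>The coefficients with which \<open>g\<^sup>k\<^sup>-\<^sup>1\<close>, \<open>g\<^sup>k\<close> and \<open>g\<^sup>k\<^sup>+\<^sup>1\<close> contribute to the coefficient of \<open>g\<^sup>k\<close>
  under \<^const>\<open>raise\<close>.\<close>

definition sub_entry :: "real \<Rightarrow> nat \<Rightarrow> real poly" where
  "sub_entry t k = (if k = 0 then 0 else [:0, t + real (k - 1):])"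

definition diag_entry :: "real \<Rightarrow> nat \<Rightarrow> real poly" where
  "diag_entry t k = [:t + real k, real k:]"

definition super_entry :: "nat \<Rightarrow> real poly" where
  "super_entry k = [:real (Suc k):]"

text \<open>The derivative lowers the degree in \<open>g\<close> by one, and its factor \<open>X(1+g) = 1 + (1+q) g + q g\<^sup>2\<close>
  raises it again by 0, 1 or 2; the term \<open>tX = t + tq g\<close> raises it by 0 or 1.\<close>

lemma coeff_raise:
  "coeff (raise t P) = tridiag (sub_entry t) (diag_entry t) super_entry (coeff P)"
proof
  fix k
  have pderiv_coeff: "coeff (pderiv P) j = smult (real (Suc j)) (coeff P (Suc j))" for j
    by (simp add: coeff_pderiv of_nat_poly del: of_nat_Suc)
  have shift_add: "pCons 0 (f + g) = pCons 0 f + pCons 0 g" for f g :: "real poly"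
    by simp
  have "raise t P = [:[:t:], [:0, t:]:] * P + [:1, [:1, 1:]:] * pderiv P
      + pCons 0 (pCons 0 (smult qX (pderiv P)))"
    by (simp add: raise_def nonexc_weight_def algebra_simps smult_add_left[symmetric] one_pCons del: smult_add_left)
  then show "coeff (raise t P) k = tridiag (sub_entry t) (diag_entry t) super_entry (coeff P) k"
    by (cases k; simp add: tridiag_def sub_entry_def diag_entry_def super_entry_def coeff_pCons
        pderiv_coeff smult_add_left shift_add del: add_pCons split: nat.splits)
qed

theorem proposition3p2:
  fixes t :: real
  assumes "t \<ge> 0"
  shows "strongly_q_log_convex (\<lambda>n. eulerian_poly n t)"
proof -
  define N where "N n = coeff (shifted_eulerian t n)" for n
  have N_Suc: "N (Suc n) = tridiag (sub_entry t) (diag_entry t) super_entry (N n)" for n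
    by (simp add: N_def shifted_eulerian_Suc coeff_raise)
  have A: "eulerian_poly n t = N n 0" for n
    by (simp add: N_def coeff_0_shifted_eulerian)
  have A_Suc: "eulerian_poly (Suc n) t = [:t:] * N n 0 + N n 1" for n
    by (simp add: A N_Suc tridiag_def sub_entry_def diag_entry_def super_entry_def
        flip: one_pCons)
  show ?thesis
    unfolding strongly_q_log_convex_def
  proof (intro allI impI, elim conjE)
    fix m n :: nat
    assume "1 \<le> m" "m \<le> n"
    have "minor (N (m - 1)) (N n) 0 1 \<ge>\<^sub>q 0"
    proof (rule minor_tridiag_iterates_nonneg[where N = N and \<alpha> = "sub_entry t"
          and \<gamma> = "diag_entry t" and \<beta> = super_entry])
      fix k
      \<comment> \<open>The mixed term \<open>q (k + 1) (t + k)\<close> of the product of the diagonal entries is what the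
        subtraction removes.\<close>
      have "diag_entry t k * diag_entry t (Suc k) - super_entry k * sub_entry t (Suc k)
          = [:(t + real k) * (t + real k + 1), real k * (t + real k + 1), real k * (real k + 1):]"
        by (simp add: diag_entry_def sub_entry_def super_entry_def algebra_simps)
      then show "diag_entry t k * diag_entry t (Suc k) - super_entry k * sub_entry t (Suc k) \<ge>\<^sub>q 0"
        using \<open>t \<ge> 0\<close> by simp
    qed (use \<open>t \<ge> 0\<close> \<open>m \<le> n\<close> N_Suc in \<open>auto simp: sub_entry_def diag_entry_def super_entry_def
        N_def shifted_eulerian_0 one_pCons coeff_pCons split: nat.splits\<close>)
    also have "minor (N (m - 1)) (N n) 0 1
        = eulerian_poly (m - 1) t * eulerian_poly (n + 1) t - eulerian_poly m t * eulerian_poly n t"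
      using A_Suc[of "m - 1"] A_Suc[of n] \<open>1 \<le> m\<close>
      by (simp add: A minor_def algebra_simps)
    finally show "eulerian_poly (m - 1) t * eulerian_poly (n + 1) t
        \<ge>\<^sub>q eulerian_poly m t * eulerian_poly n t"
      by (subst q_ge_iff_diff)
  qed
qed

end
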